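(* Let $m,n\ge 2$ be integers. For $(a,b,c)\in\mathbb{R}^3$ let $$P_{(a,b,c)}(\mathbf{x},\mathbf{y})=\sum_{i=1}^m\sum_{j=1}^n x_i^2y_j^2+a\sum_{i\ne k}\sum_{j=1}^n x_ix_ky_j^2+b\sum_{i=1}^m\sum_{j\ne l}x_i^2y_jy_l+c\sum_{i\ne k}\sum_{j\ne l}x_iy_jx_ky_l .$$ Then the set of parameters $(a,b,c)\in\mathbb{R}^3$ for which $P_{(a,b,c)}$ is PSD is a convex polyhedron (a tetrahedron) in $\mathbb{R}^3$ with vertices $$V_1=(1,1,1),\quad V_2=\left(-\tfrac1{m-1},-\tfrac1{n-1},\tfrac1{(m-1)(n-1)}\right),\quad V_3=\left(-\tfrac1{m-1},1,-\tfrac1{m-1}\right),\quad V_4=\left(1,-\tfrac1{n-1},-\tfrac1{n-1}\right).$$ That is, this PSD set is exactly the convex hull of $V_1,V_2,V_3,V_4$. Consequently, in the characterization of PSD-ness of $P_{(a,b,c)}$ by the conditions (i) $1-b+(m-1)(a-c)\ge 0$, (ii) $1-a+(n-1)(b-c)\ge 0$, (iii) $1-a-b+c\ge 0$, (iv) $1+(m-1)a+(n-1)b+(m-1)(n-1)c\ge 0$, (v) if $c\ne0$, $\frac ac\in[1-n,1)$ and $\frac bc\in[1-m,1)$, then $1-\frac{ab}{c}\ge 0$, condition (v) is redundant: every $(a,b,c)$ satisfying (i)--(iv) also satisfies (v).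
   Context: Here $\mathbf{x}=(x_1,\dots,x_m)\in\mathbb{R}^m$ and $\mathbf{y}=(y_1,\dots,y_n)\in\mathbb{R}^n$; the sums over $i\ne k$ run over all ordered pairs $(i,k)$ with $i,k\in\{1,\dots,m\}$, $i\neq k$, and the sums over $j\ne l$ over all ordered pairs $(j,l)$ with $j,l\in\{1,\dots,n\}$, $j\neq l$. $P$ is positive semi-definite (PSD) if $P(\mathbf{x},\mathbf{y})\ge 0$ for all $\mathbf{x}\in\mathbb{R}^m$, $\mathbf{y}\in\mathbb{R}^n$. *)

theory Defs
  imports "HOL-Analysis.Analysis"
begin

text \<open>
  The dimensions are type-indexed: \<open>x\<close> ranges over \<open>real ^ 'm\<close> and \<open>y\<close> over \<open>real ^ 'n\<close>, with
  \<open>CARD('m)\<close> and \<open>CARD('n)\<close> in the role of the integers \<open>m\<close> and \<open>n\<close>.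
\<close>

definition offdiag :: "('i \<times> 'i) set" where
  "offdiag = {(i, k). i \<noteq> k}"

definition biquad :: "real \<Rightarrow> real \<Rightarrow> real \<Rightarrow> real ^ 'm \<Rightarrow> real ^ 'n \<Rightarrow> real" where
  "biquad a b c x y =
     (\<Sum>i\<in>UNIV. \<Sum>j\<in>UNIV. (x $ i)\<^sup>2 * (y $ j)\<^sup>2)
   + a * (\<Sum>(i, k)\<in>offdiag. \<Sum>j\<in>UNIV. x $ i * x $ k * (y $ j)\<^sup>2)
   + b * (\<Sum>i\<in>UNIV. \<Sum>(j, l)\<in>offdiag. (x $ i)\<^sup>2 * y $ j * y $ l)
   + c * (\<Sum>(i, k)\<in>offdiag. \<Sum>(j, l)\<in>offdiag. x $ i * y $ j * x $ k * y $ l)"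

definition psd :: "(real ^ 'm \<Rightarrow> real ^ 'n \<Rightarrow> real) \<Rightarrow> bool" where
  "psd P \<longleftrightarrow> (\<forall>x y. P x y \<ge> 0)"

definition cond_i :: "nat \<Rightarrow> real \<Rightarrow> real \<Rightarrow> real \<Rightarrow> bool" where
  "cond_i m a b c \<longleftrightarrow> 1 - b + (real m - 1) * (a - c) \<ge> 0"

definition cond_ii :: "nat \<Rightarrow> real \<Rightarrow> real \<Rightarrow> real \<Rightarrow> bool" where
  "cond_ii n a b c \<longleftrightarrow> 1 - a + (real n - 1) * (b - c) \<ge> 0"

definition cond_iii :: "real \<Rightarrow> real \<Rightarrow> real \<Rightarrow> bool" where
  "cond_iii a b c \<longleftrightarrow> 1 - a - b + c \<ge> 0"

definition cond_iv :: "nat \<Rightarrow> nat \<Rightarrow> real \<Rightarrow> real \<Rightarrow> real \<Rightarrow> bool" where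
  "cond_iv m n a b c \<longleftrightarrow>
     1 + (real m - 1) * a + (real n - 1) * b + (real m - 1) * (real n - 1) * c \<ge> 0"

definition cond_v :: "nat \<Rightarrow> nat \<Rightarrow> real \<Rightarrow> real \<Rightarrow> real \<Rightarrow> bool" where
  "cond_v m n a b c \<longleftrightarrow>
     (c \<noteq> 0 \<and> a / c \<in> {1 - real n..<1} \<and> b / c \<in> {1 - real m..<1} \<longrightarrow> 1 - a * b / c \<ge> 0)"

end

theory Submission
  imports Defs
begin

text \<open>
  The form depends on \<open>x\<close> only through \<open>N = (\<Sum>i. x\<^sub>i\<^sup>2)\<close> and \<open>U = (\<Sum>i. x\<^sub>i)\<^sup>2 - N\<close>, on \<open>y\<close> only
  through the analogous \<open>M\<close> and \<open>V\<close>, and it is bilinear in the pairs \<open>(N, U)\<close> and \<open>(M, V)\<close>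
  (\<open>biquad_eq_bilinear\<close>). By Cauchy--Schwarz \<open>(N, U)\<close> lies in the planar cone
  \<open>- N \<le> U \<le> (m - 1) N\<close>, whose extreme rays \<open>U = - N\<close> and \<open>U = (m - 1) N\<close> are attained by
  \<open>e\<^sub>i - e\<^sub>k\<close> and by the all-ones vector; likewise for \<open>(M, V)\<close>. A bilinear form is nonnegative on a
  product of two such cones if and only if it is nonnegative on the four pairs of extreme rays,
  and these four conditions are exactly (i)--(iv) (\<open>psd_biquad_iff\<close>).

  Conditions (i)--(iv) are affine in \<open>(a, b, c)\<close>. Each of them is strict at exactly one of the
  vertices \<open>V\<^sub>1, \<dots>, V\<^sub>4\<close> and an equality at the other three, so the suitably scaled left-hand sides
  are the barycentric coordinates for these vertices. Hence the region is the tetrahedron spanned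
  by them (\<open>psd_region_eq_convex_hull\<close>); it is nondegenerate because the vertices are affinely
  independent (\<open>tetrahedron_affine_independent\<close>).

  For the redundancy of (v), the substitution \<open>u = - b / c\<close>, \<open>v = - a / c\<close> turns the dehomogenised
  form \<open>1 + a u + b v + c u v\<close> into \<open>1 - a b / c\<close>, and the hypotheses of (v) place \<open>(u, v)\<close> in the
  box on which (i)--(iv) make that form nonnegative.
\<close>

section \<open>Reduction to a bilinear form in two planar cones\<close>

lemma sum_offdiag:
  fixes f :: "'i::finite \<Rightarrow> real"
  shows "(\<Sum>(i, k)\<in>offdiag. f i * f k) = (\<Sum>i\<in>UNIV. f i)\<^sup>2 - (\<Sum>i\<in>UNIV. (f i)\<^sup>2)"
proof -
  let ?g = "\<lambda>(i, k). f i * f k"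
  have split: "(UNIV :: ('i \<times> 'i) set) = offdiag \<union> range (\<lambda>i. (i, i))"
    and disj: "offdiag \<inter> range (\<lambda>i::'i. (i, i)) = {}"
    by (auto simp: offdiag_def)
  have "(\<Sum>i\<in>UNIV. f i)\<^sup>2 = sum ?g UNIV"
    by (simp add: power2_eq_square sum_product sum.cartesian_product)
  also have "\<dots> = sum ?g offdiag + sum ?g (range (\<lambda>i. (i, i)))"
    unfolding split using disj by (intro sum.union_disjoint) auto
  also have "sum ?g (range (\<lambda>i. (i, i))) = (\<Sum>i\<in>UNIV. (f i)\<^sup>2)"
    by (subst sum.reindex) (auto simp: inj_on_def power2_eq_square)
  finally show ?thesis by simp
qed

lemma biquad_eq_bilinear:
  fixes x :: "real ^ 'm" and y :: "real ^ 'n"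
  defines "N \<equiv> \<Sum>i\<in>UNIV. (x $ i)\<^sup>2" and "U \<equiv> (\<Sum>i\<in>UNIV. x $ i)\<^sup>2 - (\<Sum>i\<in>UNIV. (x $ i)\<^sup>2)"
    and "M \<equiv> \<Sum>j\<in>UNIV. (y $ j)\<^sup>2" and "V \<equiv> (\<Sum>j\<in>UNIV. y $ j)\<^sup>2 - (\<Sum>j\<in>UNIV. (y $ j)\<^sup>2)"
  shows "biquad a b c x y = N * M + a * (U * M) + b * (N * V) + c * (U * V)"
proof -
  have "(\<Sum>(i, k)\<in>offdiag. \<Sum>j\<in>UNIV. x $ i * x $ k * (y $ j)\<^sup>2) = U * M"
    and "(\<Sum>i\<in>UNIV. \<Sum>(j, l)\<in>offdiag. (x $ i)\<^sup>2 * y $ j * y $ l) = N * V"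
    and "(\<Sum>(i, k)\<in>offdiag. \<Sum>(j, l)\<in>offdiag. x $ i * y $ j * x $ k * y $ l) = U * V"
    unfolding assms sum_offdiag[symmetric] sum_product
    by (simp_all add: case_prod_unfold mult_ac)
  then show ?thesis
    by (simp add: biquad_def N_def M_def sum_product)
qed

text \<open>
  The expressions \<open>N + U\<close> and \<open>(m - 1) N - U\<close> are the coordinates of \<open>(N, U)\<close> with respect to the
  extreme rays of its cone. Expanding the bilinear form in these coordinates makes the left-hand
  sides of (i)--(iv) appear as its coefficients.
\<close>

lemma bilinear_in_extreme_ray_coordinates:
  fixes m n a b c N U M V :: real
  shows "m * n * (N * M + a * (U * M) + b * (N * V) + c * (U * V)) =
      (N + U) * ((n - 1) * M - V) * (1 - b + (m - 1) * (a - c))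
    + ((m - 1) * N - U) * (M + V) * (1 - a + (n - 1) * (b - c))
    + ((m - 1) * N - U) * ((n - 1) * M - V) * (1 - a - b + c)
    + (N + U) * (M + V) * (1 + (m - 1) * a + (n - 1) * b + (m - 1) * (n - 1) * c)"
  by (simp add: algebra_simps)

lemma square_sums_in_cone:
  fixes x :: "real ^ 'm"
  defines "N \<equiv> \<Sum>i\<in>UNIV. (x $ i)\<^sup>2" and "U \<equiv> (\<Sum>i\<in>UNIV. x $ i)\<^sup>2 - (\<Sum>i\<in>UNIV. (x $ i)\<^sup>2)"
  shows "- N \<le> U" and "U \<le> (real CARD('m) - 1) * N"
  unfolding assms using sum_squared_le_sum_of_squares[of "\<lambda>i. x $ i" UNIV]
  by (simp_all add: algebra_simps)

lemma bilinear_nonneg_on_cones: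
  assumes conds: "cond_i m a b c" "cond_ii n a b c" "cond_iii a b c" "cond_iv m n a b c"
    and "m > 0" "n > 0"
    and "- N \<le> U" "U \<le> (real m - 1) * N" "- M \<le> V" "V \<le> (real n - 1) * M"
  shows "0 \<le> N * M + a * (U * M) + b * (N * V) + c * (U * V)"
proof -
  have rays: "0 \<le> N + U" "0 \<le> (real m - 1) * N - U" "0 \<le> M + V" "0 \<le> (real n - 1) * M - V"
    using assms(7-10) by simp_all
  have "0 \<le> real m * real n * (N * M + a * (U * M) + b * (N * V) + c * (U * V))"
    unfolding bilinear_in_extreme_ray_coordinates
    by (intro add_nonneg_nonneg mult_nonneg_nonneg[OF mult_nonneg_nonneg] rays
        conds[unfolded cond_i_def cond_ii_def cond_iii_def cond_iv_def])
  with \<open>m > 0\<close> \<open>n > 0\<close> show ?thesis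
    by (simp add: zero_le_mult_iff mult_le_0_iff)
qed

section \<open>Positive semidefiniteness as four linear inequalities\<close>

lemma sum_axis_diff:
  fixes i k :: "'i::finite"
  assumes "i \<noteq> k"
  defines "x \<equiv> axis i 1 - axis k 1 :: real ^ 'i"
  shows "(\<Sum>j\<in>UNIV. x $ j) = 0" and "(\<Sum>j\<in>UNIV. (x $ j)\<^sup>2) = 2"
proof -
  show "(\<Sum>j\<in>UNIV. x $ j) = 0"
    by (simp add: x_def axis_def sum_subtractf)
  have "(x $ j)\<^sup>2 = (if j = i then 1 else 0) + (if j = k then 1 else 0)" for j
    using assms by (auto simp: axis_def)
  then show "(\<Sum>j\<in>UNIV. (x $ j)\<^sup>2) = 2"
    by (simp add: sum.distrib)
qed

lemma psd_biquad_iff: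
  assumes "CARD('m::finite) \<ge> 2" and "CARD('n::finite) \<ge> 2"
  shows "psd (biquad a b c :: real ^ 'm \<Rightarrow> real ^ 'n \<Rightarrow> real) \<longleftrightarrow>
    cond_i CARD('m) a b c \<and> cond_ii CARD('n) a b c \<and> cond_iii a b c
      \<and> cond_iv CARD('m) CARD('n) a b c"
    (is "psd ?P \<longleftrightarrow> ?conds")
proof
  assume ?conds
  show "psd ?P"
    unfolding psd_def biquad_eq_bilinear
    using \<open>?conds\<close> by (auto intro!: bilinear_nonneg_on_cones square_sums_in_cone)
next
  assume "psd ?P"
  then have nonneg: "0 \<le> ?P x y" for x y
    by (simp add: psd_def)
  define p q where "p = real CARD('m) - 1" and "q = real CARD('n) - 1"
  have card: "real CARD('m) = p + 1" "real CARD('n) = q + 1" and pos: "p > 0" "q > 0"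
    using assms by (simp_all add: p_def q_def)
  obtain i k :: 'm where ik: "i \<noteq> k"
    using assms(1) card_le_Suc0_iff_eq[OF finite] by (metis not_less_eq_eq numeral_2_eq_2)
  obtain j l :: 'n where jl: "j \<noteq> l"
    using assms(2) card_le_Suc0_iff_eq[OF finite] by (metis not_less_eq_eq numeral_2_eq_2)
  have one_neg: "0 \<le> 2 * ((p + 1) * (1 - b + p * (a - c)))"
    using nonneg[of "vec 1" "axis j 1 - axis l 1"]
    unfolding biquad_eq_bilinear sum_axis_diff[OF jl]
    by (simp add: card power2_eq_square algebra_simps)
  have neg_one: "0 \<le> 2 * ((q + 1) * (1 - a + q * (b - c)))"
    using nonneg[of "axis i 1 - axis k 1" "vec 1"]
    unfolding biquad_eq_bilinear sum_axis_diff[OF ik]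
    by (simp add: card power2_eq_square algebra_simps)
  have neg_neg: "0 \<le> 4 * (1 - a - b + c)"
    using nonneg[of "axis i 1 - axis k 1" "axis j 1 - axis l 1"]
    unfolding biquad_eq_bilinear sum_axis_diff[OF ik] sum_axis_diff[OF jl]
    by (simp add: algebra_simps)
  have one_one: "0 \<le> (p + 1) * ((q + 1) * (1 + p * a + q * b + p * q * c))"
    using nonneg[of "vec 1" "vec 1"]
    unfolding biquad_eq_bilinear
    by (simp add: card power2_eq_square algebra_simps)
  show ?conds
    using one_neg neg_one neg_neg one_one pos
    unfolding cond_i_def cond_ii_def cond_iii_def cond_iv_def card
    by (simp add: zero_le_mult_iff)
qed

text \<open>
  Writing \<open>1 + a u + b v + c u v = c (u + b / c) (v + a / c) + 1 - a b / c\<close> shows that the left-hand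
  side of (v) is the critical value of the dehomogenised form, attained at a point of the box
  \<open>[-1, m - 1] \<times> [-1, n - 1]\<close> exactly under the hypotheses of (v) (up to boundary points).
\<close>

lemma cond_v_redundant:
  assumes "cond_i m a b c" "cond_ii n a b c" "cond_iii a b c" "cond_iv m n a b c"
    and "m > 0" "n > 0"
  shows "cond_v m n a b c"
  unfolding cond_v_def
proof (intro impI, elim conjE)
  assume "c \<noteq> 0" and a: "a / c \<in> {1 - real n..<1}" and b: "b / c \<in> {1 - real m..<1}"
  have "0 \<le> 1 * 1 + a * (- (b / c) * 1) + b * (1 * - (a / c)) + c * (- (b / c) * - (a / c))"
    using a b by (intro bilinear_nonneg_on_cones[OF assms]) auto
  with \<open>c \<noteq> 0\<close> show "0 \<le> 1 - a * b / c"
    by (simp add: mult.commute)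
qed

section \<open>The region as a tetrahedron\<close>

lemma convex_halfspace_triple: "convex {(a, b, c). (0::real) \<le> k + \<alpha> * a + \<beta> * b + \<gamma> * c}"
proof -
  have "{(a, b, c). 0 \<le> k + \<alpha> * a + \<beta> * b + \<gamma> * c} = {v. inner (\<alpha>, \<beta>, \<gamma>) v \<ge> - k}"
    by (auto simp: algebra_simps)
  then show ?thesis
    by (simp only: convex_halfspace_ge)
qed

lemma convex_combination_4_in_hull:
  fixes A B C D :: "'a::real_vector"
  assumes "s \<ge> 0" "t \<ge> 0" "u \<ge> 0" "v \<ge> 0" and "s + t + u + v = 1"
  shows "s *\<^sub>R A + t *\<^sub>R B + u *\<^sub>R C + v *\<^sub>R D \<in> convex hull {A, B, C, D}"
proof -
  have "(\<Sum>i\<in>{..<4::nat}. ([s, t, u, v] ! i) *\<^sub>R ([A, B, C, D] ! i)) \<in> convex hull {A, B, C, D}"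
  proof (rule convex_sum)
    show "(\<Sum>i\<in>{..<4::nat}. [s, t, u, v] ! i) = 1"
      using assms(5) by (simp add: eval_nat_numeral)
    fix i :: nat
    assume "i \<in> {..<4}"
    then have "i = 0 \<or> i = 1 \<or> i = 2 \<or> i = 3" by auto
    then show "0 \<le> [s, t, u, v] ! i" and "[A, B, C, D] ! i \<in> convex hull {A, B, C, D}"
      using assms(1-4) by (auto intro: hull_inc)
  qed auto
  then show ?thesis
    by (simp add: eval_nat_numeral)
qed

text \<open>
  The weights below are the left-hand sides of (iv), (iii), (ii), (i), each divided by its value
  at the one vertex where it does not vanish.
\<close>

lemma psd_region_eq_convex_hull:
  fixes m n :: nat
  assumes "m \<ge> 2" and "n \<ge> 2"
  shows "{(a, b, c). cond_i m a b c \<and> cond_ii n a b c \<and> cond_iii a b c \<and> cond_iv m n a b c} =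
    convex hull {(1, 1, 1),
      (- 1 / (real m - 1), - 1 / (real n - 1), 1 / ((real m - 1) * (real n - 1))),
      (- 1 / (real m - 1), 1, - 1 / (real m - 1)),
      (1, - 1 / (real n - 1), - 1 / (real n - 1))}"
    (is "?R = convex hull ?V")
proof
  define p q where "p = real m - 1" and "q = real n - 1"
  have pos: "p > 0" "q > 0"
    using assms by (simp_all add: p_def q_def)
  note conds = cond_i_def cond_ii_def cond_iii_def cond_iv_def p_def[symmetric] q_def[symmetric]
  have "?R = {(a, b, c). 0 \<le> 1 + p * a + (- 1) * b + (- p) * c}
      \<inter> {(a, b, c). 0 \<le> 1 + (- 1) * a + q * b + (- q) * c}
      \<inter> {(a, b, c). 0 \<le> 1 + (- 1) * a + (- 1) * b + 1 * c}
      \<inter> {(a, b, c). 0 \<le> 1 + p * a + q * b + (p * q) * c}"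
    unfolding conds by (auto simp: algebra_simps)
  then have "convex ?R"
    by (simp only: convex_Int convex_halfspace_triple)
  moreover have "?V \<subseteq> ?R"
    unfolding conds using pos
    by (auto simp: field_simps) (use pos mult_pos_pos[OF pos] in linarith)+
  ultimately show "convex hull ?V \<subseteq> ?R"
    by (rule hull_minimal[rotated])
  show "?R \<subseteq> convex hull ?V"
  proof clarify
    fix a b c
    assume i: "cond_i m a b c" and ii: "cond_ii n a b c" and iii: "cond_iii a b c"
      and iv: "cond_iv m n a b c"
    define d where "d = (p + 1) * (q + 1)"
    have "d > 0" using pos by (simp add: d_def)
    define s where "s = (1 + p * a + q * b + p * q * c) / d"
    define t where "t = p * q * (1 - a - b + c) / d"
    define u where "u = p * (1 - a + q * (b - c)) / d"
    define v where "v = q * (1 - b + p * (a - c)) / d"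
    have nonneg: "s \<ge> 0" "t \<ge> 0" "u \<ge> 0" "v \<ge> 0"
      using i ii iii iv pos \<open>d > 0\<close> unfolding conds s_def t_def u_def v_def by simp_all
    have "s + t + u + v = d / d"
      unfolding s_def t_def u_def v_def add_divide_distrib[symmetric]
      by (simp add: d_def algebra_simps)
    then have total: "s + t + u + v = 1" using \<open>d > 0\<close> by simp
    have "s - t / p - u / p + v = a" "s - t / q + u - v / q = b"
      "s + t / (p * q) - u / p - v / q = c"
      unfolding s_def t_def u_def v_def using pos \<open>d > 0\<close>
      by (simp_all add: field_simps) (simp_all add: d_def algebra_simps)
    then have combination: "(a, b, c) = s *\<^sub>R (1, 1, 1) + t *\<^sub>R (- 1 / p, - 1 / q, 1 / (p * q))
        + u *\<^sub>R (- 1 / p, 1, - 1 / p) + v *\<^sub>R (1, - 1 / q, - 1 / q)"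
      by simp
    then show "(a, b, c) \<in> convex hull ?V"
      unfolding p_def[symmetric] q_def[symmetric]
      by (simp only: combination convex_combination_4_in_hull[OF nonneg total])
  qed
qed

text \<open>
  The four points are \<open>(\<alpha>, \<beta>, \<alpha> \<beta>)\<close> with \<open>\<alpha> \<in> {1, - 1 / p}\<close> and \<open>\<beta> \<in> {1, - 1 / q}\<close>. In an affine
  dependence the first two coordinates force opposite weights on points that share \<open>\<alpha>\<close> or share
  \<open>\<beta>\<close>, so the weights are \<open>\<plusminus>t\<close> in a checkerboard pattern; the product coordinate then gives
  \<open>t (1 + 1 / p) (1 + 1 / q) = 0\<close>.
\<close>

lemma tetrahedron_affine_independent:
  fixes p q :: real
  assumes "p > 0" and "q > 0"
  defines "V \<equiv> {(1, 1, 1), (- 1 / p, - 1 / q, 1 / (p * q)), (- 1 / p, 1, - 1 / p), (1, - 1 / q, - 1 / q)}"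
  shows "card V = 4" and "\<not> affine_dependent V"
proof -
  have neg: "- 1 / p < 0" "- 1 / q < 0"
    using assms by auto
  then have ne: "- 1 / p \<noteq> 1" "1 \<noteq> - 1 / p" "- 1 / q \<noteq> 1" "1 \<noteq> - 1 / q"
    by linarith+
  show "card V = 4"
    unfolding V_def using ne by simp
  show "\<not> affine_dependent V"
  proof
    assume "affine_dependent V"
    have "finite V" by (simp add: V_def)
    with \<open>affine_dependent V\<close> obtain f where f0: "sum f V = 0" and f1: "\<exists>v\<in>V. f v \<noteq> 0"
      and f2: "(\<Sum>v\<in>V. f v *\<^sub>R v) = 0"
      unfolding affine_dependent_explicit_finite[OF \<open>finite V\<close>] by blast
    define s t u v where w: "s = f (1, 1, 1)" "t = f (- 1 / p, - 1 / q, 1 / (p * q))"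
      "u = f (- 1 / p, 1, - 1 / p)" "v = f (1, - 1 / q, - 1 / q)"
    have total: "s + t + u + v = 0"
      using f0 ne unfolding V_def w by simp
    have comb: "s *\<^sub>R (1, 1, 1) + t *\<^sub>R (- 1 / p, - 1 / q, 1 / (p * q))
        + u *\<^sub>R (- 1 / p, 1, - 1 / p) + v *\<^sub>R (1, - 1 / q, - 1 / q) = (0, 0, 0)"
      using f2 ne unfolding V_def w by (simp add: zero_prod_def)
    have eqs: "s + v = (t + u) / p" "s + u = (t + v) / q" "s + t / (p * q) - u / p - v / q = 0"
      using comb by (simp_all add: add_divide_distrib algebra_simps)
    have pos: "1 + 1 / p > 0" "1 + 1 / q > 0"
      using assms(1,2) by (intro add_pos_pos; simp)+
    have "(t + u) * (1 + 1 / p) = 0" "(t + v) * (1 + 1 / q) = 0"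
      using eqs(1,2) total by (simp_all add: distrib_left)
    then have "t + u = 0" "t + v = 0"
      using pos by simp_all
    then have uvs: "u = - t" "v = - t" "s = t"
      using total by linarith+
    then have "t * ((1 + 1 / p) * (1 + 1 / q)) = 0"
      using eqs(3) by (simp add: algebra_simps)
    then have "t = 0"
      using pos by simp
    with uvs f1 show False
      unfolding V_def w by auto
  qed
qed

theorem theorem4p3:
  fixes m n :: nat
    and S :: "(real \<times> real \<times> real) set"
    and V1 V2 V3 V4 :: "real \<times> real \<times> real"
  assumes "m = CARD('m::finite)" and "n = CARD('n::finite)"
    and "m \<ge> 2" and "n \<ge> 2"
    and "S = {(a, b, c). psd (biquad a b c :: real ^ 'm \<Rightarrow> real ^ 'n \<Rightarrow> real)}"
    and "V1 = (1, 1, 1)"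
    and "V2 = (- 1 / (real m - 1), - 1 / (real n - 1), 1 / ((real m - 1) * (real n - 1)))"
    and "V3 = (- 1 / (real m - 1), 1, - 1 / (real m - 1))"
    and "V4 = (1, - 1 / (real n - 1), - 1 / (real n - 1))"
  shows "S = convex hull {V1, V2, V3, V4}
    \<and> polyhedron S \<and> 3 simplex S \<and> {v. v extreme_point_of S} = {V1, V2, V3, V4}
    \<and> (\<forall>a b c. psd (biquad a b c :: real ^ 'm \<Rightarrow> real ^ 'n \<Rightarrow> real) \<longleftrightarrow>
          cond_i m a b c \<and> cond_ii n a b c \<and> cond_iii a b c \<and> cond_iv m n a b c \<and> cond_v m n a b c)
    \<and> (\<forall>a b c. cond_i m a b c \<and> cond_ii n a b c \<and> cond_iii a b c \<and> cond_iv m n a b c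
          \<longrightarrow> cond_v m n a b c)"
proof -
  let ?V = "{V1, V2, V3, V4}"
  have psd_iff: "psd (biquad a b c :: real ^ 'm \<Rightarrow> real ^ 'n \<Rightarrow> real) \<longleftrightarrow>
      cond_i m a b c \<and> cond_ii n a b c \<and> cond_iii a b c \<and> cond_iv m n a b c" for a b c
    using psd_biquad_iff assms(1-4) by blast
  have hull: "S = convex hull ?V"
    using psd_region_eq_convex_hull[OF assms(3,4)] by (simp only: assms(5-9) psd_iff)
  have "real m - 1 > 0" "real n - 1 > 0"
    using assms(3,4) by simp_all
  then have indep: "card ?V = 4" "\<not> affine_dependent ?V"
    using tetrahedron_affine_independent by (simp_all only: assms(6-9) not_False_eq_True)
  have "polyhedron S"
    unfolding hull by (intro polyhedron_convex_hull) simp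
  moreover have "3 simplex S"
    unfolding simplex_def hull using indep by (intro exI[of _ ?V]) simp
  moreover have "{v. v extreme_point_of S} = ?V"
    unfolding hull using extreme_point_of_convex_hull_affine_independent[OF indep(2)] by blast
  moreover have "cond_v m n a b c"
    if "cond_i m a b c" "cond_ii n a b c" "cond_iii a b c" "cond_iv m n a b c" for a b c
    using cond_v_redundant[OF that] assms(3,4) by simp
  ultimately show ?thesis
    using hull psd_iff by blast
qed

end
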